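(* Let $x_T$ be the number of fully overlapped elements when independent uniformly random subsets of sizes $m_1,\dots,m_T$ are drawn from an $n$-element set, where $T\ge2$, $n\ge 1$ and $1\le m_i\le n$ for all $i$. Then $$E(x_T)>\mathrm{Var}(x_T),$$ and the difference $E(x_T)-\mathrm{Var}(x_T)$ is a higher order infinitesimal of $E(x_T)$ when $E(x_T)\to0$; that is, along any sequence of parameters $(T;n;m_1,\dots,m_T)$ with $T\ge2$, $n\ge1$ and $1\le m_i\le n$ for all $1\le i\le T$, and with $E(x_T)\to 0$, $$\frac{E(x_T)-\mathrm{Var}(x_T)}{E(x_T)}\to 0.$$
   Context: General hypergeometric distribution: let $N$ be a finite set with $n$ elements. Choose subsets $M_1,\dots,M_T$ of $N$ independently, $M_i$ being uniformly distributed among all $\binom{n}{m_i}$ subsets of $N$ of size $m_i$. The random variable $x_T$ is the number of elements of $N$ that belong to all of the sets $M_1,\dots,M_T$. *)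

theory Defs
  imports "HOL-Probability.Probability"
begin

text \<open>
  Coordinates outside \<open>{1..T}\<close> of an outcome are fixed to the default value \<open>{}\<close> by
  \<^const>\<open>Pi_pmf\<close> and carry no information.
\<close>
definition draws_pmf :: "'a set \<Rightarrow> nat \<Rightarrow> (nat \<Rightarrow> nat) \<Rightarrow> (nat \<Rightarrow> 'a set) pmf" where
  "draws_pmf N T m = Pi_pmf {1..T} {} (\<lambda>i. pmf_of_set {M. M \<subseteq> N \<and> card M = m i})"

definition overlap :: "'a set \<Rightarrow> nat \<Rightarrow> (nat \<Rightarrow> 'a set) \<Rightarrow> nat" where
  "overlap N T M = card {e \<in> N. \<forall>i\<in>{1..T}. e \<in> M i}"

definition overlap_expectation :: "'a set \<Rightarrow> nat \<Rightarrow> (nat \<Rightarrow> nat) \<Rightarrow> real" where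
  "overlap_expectation N T m =
     measure_pmf.expectation (draws_pmf N T m) (\<lambda>M. real (overlap N T M))"

definition overlap_variance :: "'a set \<Rightarrow> nat \<Rightarrow> (nat \<Rightarrow> nat) \<Rightarrow> real" where
  "overlap_variance N T m =
     measure_pmf.variance (draws_pmf N T m) (\<lambda>M. real (overlap N T M))"

text \<open>
  The ground set is an arbitrary finite set of size \<open>n\<close> in an arbitrary type; taking the
  element type to be \<^typ>\<open>nat\<close> admits sequences of parameters with unbounded \<open>n\<close>.
\<close>
definition admissible :: "'a set \<Rightarrow> nat \<Rightarrow> nat \<Rightarrow> (nat \<Rightarrow> nat) \<Rightarrow> bool" where
  "admissible N T n m \<longleftrightarrow>
     finite N \<and> card N = n \<and> n \<ge> 1 \<and> T \<ge> 2 \<and> (\<forall>i\<in>{1..T}. 1 \<le> m i \<and> m i \<le> n)"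

end

theory Submission
  imports Defs
begin

text \<open>
  The binomial moments of the overlap \<open>x\<close> are explicit. A \<open>k\<close>-element subset of the common part
  of the draws is a \<open>k\<close>-subset of \<open>N\<close> contained in every \<open>M i\<close>, and a fixed \<open>k\<close>-set is contained
  in a random \<open>m\<close>-set with probability \<open>(m choose k) / (n choose k)\<close>; so by independence
  \<open>E (x choose k) = (n choose k) * (\<Prod>i. (m i choose k) / (n choose k))\<close>.
  For \<open>k = 1\<close> this is \<open>E x = n * (\<Prod>i. m i / n)\<close>. Since \<open>x\<^sup>2 = x + 2 * (x choose 2)\<close>,
  the case \<open>k = 2\<close> gives \<open>E x - Var x = (E x)\<^sup>2 - 2 * E (x choose 2)\<close>.

  Containing two given points is at most as likely for an \<open>m\<close>-set as containing one point
  twice independently, that is, \<open>(m choose 2) / (n choose 2) \<le> (m / n)\<^sup>2\<close>; as also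
  \<open>2 * (n choose 2) < n\<^sup>2\<close>, this shows \<open>2 * E (x choose 2) < (E x)\<^sup>2\<close>. Hence
  \<open>0 < E x - Var x \<le> (E x)\<^sup>2\<close>, where the lower bound is the first claim, and dividing by \<open>E x\<close>
  turns the upper bound into the second.
\<close>

section \<open>Binomial moments of the overlap\<close>

text \<open>
  Removing \<open>S\<close> is a bijection from the favourable sets onto the \<open>(m - card S)\<close>-subsets of \<open>N - S\<close>.
\<close>
lemma card_supersets:
  assumes "finite N" "S \<subseteq> N" "card S \<le> m"
  shows "card {M. M \<subseteq> N \<and> card M = m \<and> S \<subseteq> M} = (card N - card S) choose (m - card S)"
proof -
  have fS: "finite S" using assms finite_subset by blast
  have "bij_betw (\<lambda>M. M - S) {M. M \<subseteq> N \<and> card M = m \<and> S \<subseteq> M}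
          {M. M \<subseteq> N - S \<and> card M = m - card S}"
  proof (rule bij_betw_byWitness[where f' = "\<lambda>M. M \<union> S"])
    show "(\<lambda>M. M - S) ` {M. M \<subseteq> N \<and> card M = m \<and> S \<subseteq> M} \<subseteq> {M. M \<subseteq> N - S \<and> card M = m - card S}"
      using fS by (auto simp: card_Diff_subset)
    show "(\<lambda>M. M \<union> S) ` {M. M \<subseteq> N - S \<and> card M = m - card S} \<subseteq> {M. M \<subseteq> N \<and> card M = m \<and> S \<subseteq> M}"
    proof safe
      fix M assume M: "M \<subseteq> N - S" "card M = m - card S"
      have "finite M" using M(1) assms(1) finite_subset by blast
      hence "card (M \<union> S) = card M + card S"
        using M(1) fS by (intro card_Un_disjoint) auto
      thus "card (M \<union> S) = m" using M(2) assms(3) by simp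
    qed (use assms(2) in auto)
  qed auto
  hence "card {M. M \<subseteq> N \<and> card M = m \<and> S \<subseteq> M} = card {M. M \<subseteq> N - S \<and> card M = m - card S}"
    by (rule bij_betw_same_card)
  also have "\<dots> = (card N - card S) choose (m - card S)"
    using assms fS by (simp add: n_subsets card_Diff_subset)
  finally show ?thesis .
qed

lemma finite_nonempty_subsets_of_card:
  assumes "finite N" "m \<le> card N"
  shows "finite {M. M \<subseteq> N \<and> card M = m}" "{M. M \<subseteq> N \<and> card M = m} \<noteq> {}"
  using assms obtain_subset_with_card_n[of m N] by auto

text \<open>
  The count above yields \<open>(n - k choose m - k) / (n choose m)\<close>; trading the two lower indices makes
  the formula valid also for \<open>m < k\<close>, where both sides vanish.
\<close>
lemma prob_superset:
  assumes "finite N" "S \<subseteq> N" "m \<le> card N"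
  shows "measure_pmf.prob (pmf_of_set {M. M \<subseteq> N \<and> card M = m}) {M. S \<subseteq> M}
           = real (m choose card S) / real (card N choose card S)"
proof -
  define n k where "n = card N" and "k = card S"
  have k: "k \<le> n" using assms by (simp add: n_def k_def card_mono)
  have m: "m \<le> n" using assms by (simp add: n_def)
  have "measure_pmf.prob (pmf_of_set {M. M \<subseteq> N \<and> card M = m}) {M. S \<subseteq> M}
      = card ({M. M \<subseteq> N \<and> card M = m} \<inter> {M. S \<subseteq> M}) / card {M. M \<subseteq> N \<and> card M = m}"
    using finite_nonempty_subsets_of_card[OF assms(1,3)] by (simp add: measure_pmf_of_set)
  also have "{M. M \<subseteq> N \<and> card M = m} \<inter> {M. S \<subseteq> M} = {M. M \<subseteq> N \<and> card M = m \<and> S \<subseteq> M}"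
    by auto
  finally have prob: "measure_pmf.prob (pmf_of_set {M. M \<subseteq> N \<and> card M = m}) {M. S \<subseteq> M}
      = real (card {M. M \<subseteq> N \<and> card M = m \<and> S \<subseteq> M}) / real (n choose m)"
    using assms(1) by (simp add: n_subsets n_def)
  have "real (card {M. M \<subseteq> N \<and> card M = m \<and> S \<subseteq> M}) / real (n choose m)
      = real (m choose k) / real (n choose k)"
  proof (cases "k \<le> m")
    case True
    have "real ((n - k) choose (m - k)) * real (n choose k) = real (m choose k) * real (n choose m)"
      using choose_mult[OF True m] by (metis mult.commute of_nat_mult)
    moreover have "n choose m \<noteq> 0" "n choose k \<noteq> 0"
      using m k by (simp_all add: binomial_eq_0_iff)
    ultimately show ?thesis
      using card_supersets[of N S m] assms True by (simp add: frac_eq_eq n_def k_def)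
  next
    case False
    have "{M. M \<subseteq> N \<and> card M = m \<and> S \<subseteq> M} = {}"
    proof safe
      fix M assume "M \<subseteq> N" "S \<subseteq> M" "m = card M"
      hence "k \<le> m" using assms(1) by (auto simp: k_def intro: card_mono finite_subset)
      thus "M \<in> {}" using False by simp
    qed
    thus ?thesis using False by (simp only: card.empty) (simp add: binomial_eq_0)
  qed
  thus ?thesis using prob by (simp add: n_def k_def)
qed

lemma prob_superset_draws:
  assumes "finite N" "S \<subseteq> N" "\<And>i. i \<in> {1..T} \<Longrightarrow> m i \<le> card N"
  shows "measure_pmf.prob (draws_pmf N T m) {M. \<forall>i\<in>{1..T}. S \<subseteq> M i}
           = (\<Prod>i\<in>{1..T}. real (m i choose card S) / real (card N choose card S))"
proof -
  have "{M. \<forall>i\<in>{1..T}. S \<subseteq> M i} = Pi {1..T} (\<lambda>_. {A. S \<subseteq> A})"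
    by (auto simp: Pi_def)
  thus ?thesis
    unfolding draws_pmf_def
    using assms by (simp add: measure_Pi_pmf_Pi prob_superset)
qed

lemma finite_set_draws_pmf:
  assumes "finite N" "\<And>i. i \<in> {1..T} \<Longrightarrow> m i \<le> card N"
  shows "finite (set_pmf (draws_pmf N T m))"
proof -
  have "set_pmf (draws_pmf N T m) = PiE_dflt {1..T} {} (\<lambda>i. {M. M \<subseteq> N \<and> card M = m i})"
    unfolding draws_pmf_def using finite_nonempty_subsets_of_card[OF assms(1) assms(2)]
    by (auto simp: set_Pi_pmf PiE_dflt_def)
  thus ?thesis using assms by (auto intro!: finite_PiE_dflt)
qed

lemma expectation_overlap_choose:
  assumes "finite N" "\<And>i. i \<in> {1..T} \<Longrightarrow> m i \<le> card N"
  shows "measure_pmf.expectation (draws_pmf N T m) (\<lambda>M. real (overlap N T M choose k))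
           = real (card N choose k) * (\<Prod>i\<in>{1..T}. real (m i choose k) / real (card N choose k))"
proof -
  let ?K = "{S. S \<subseteq> N \<and> card S = k}"
  let ?E = "\<lambda>S. {M. \<forall>i\<in>{1..T}. S \<subseteq> M i}"
  have fK: "finite ?K" using assms(1) by simp
  have count: "real (overlap N T M choose k) = (\<Sum>S\<in>?K. indicator (?E S) M)" for M
  proof -
    let ?C = "{e \<in> N. \<forall>i\<in>{1..T}. e \<in> M i}"
    have "overlap N T M choose k = card {S. S \<subseteq> ?C \<and> card S = k}"
      using assms(1) by (simp add: overlap_def n_subsets)
    also have "{S. S \<subseteq> ?C \<and> card S = k} = {S \<in> ?K. M \<in> ?E S}"
      by auto
    finally show ?thesis
      using fK by (simp add: indicator_def sum.If_cases Int_def)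
  qed
  have "measure_pmf.expectation (draws_pmf N T m) (\<lambda>M. real (overlap N T M choose k))
      = (\<Sum>S\<in>?K. measure_pmf.expectation (draws_pmf N T m) (indicator (?E S)))"
    unfolding count
    by (intro Bochner_Integration.integral_sum integrable_measure_pmf_finite
          finite_set_draws_pmf assms)
  also have "\<dots> = (\<Sum>S\<in>?K. \<Prod>i\<in>{1..T}. real (m i choose k) / real (card N choose k))"
    using assms prob_superset_draws[OF assms(1) _ assms(2)] by (intro sum.cong) auto
  also have "\<dots> = real (card N choose k) * (\<Prod>i\<in>{1..T}. real (m i choose k) / real (card N choose k))"
    using assms(1) by (simp add: n_subsets)
  finally show ?thesis .
qed

section \<open>Comparison of expectation and variance\<close>

lemma real_choose_two: "2 * real (n choose 2) = real n * (real n - 1)"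
proof -
  have "2 * (n choose 2) = n * (n - 1)" unfolding choose_two by (rule dvd_mult_div_cancel) auto
  hence "2 * real (n choose 2) = real n * real (n - 1)"
    by (metis of_nat_mult of_nat_numeral)
  thus ?thesis by (cases n) auto
qed

text \<open>
  Expressing \<open>x\<^sup>2\<close> through binomials makes the linear parts of \<open>E x\<close> and \<open>Var x\<close> cancel.
\<close>
lemma expectation_minus_variance:
  assumes "finite N" "\<And>i. i \<in> {1..T} \<Longrightarrow> m i \<le> card N"
  shows "overlap_expectation N T m - overlap_variance N T m
           = (overlap_expectation N T m)\<^sup>2
             - 2 * measure_pmf.expectation (draws_pmf N T m) (\<lambda>M. real (overlap N T M choose 2))"
proof -
  let ?E = "measure_pmf.expectation (draws_pmf N T m)"
  have int: "integrable (measure_pmf (draws_pmf N T m)) f" for f :: "_ \<Rightarrow> real"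
    by (intro integrable_measure_pmf_finite finite_set_draws_pmf assms)
  have sq: "(real (overlap N T M))\<^sup>2 = 2 * real (overlap N T M choose 2) + real (overlap N T M)" for M
    by (simp add: real_choose_two power2_eq_square algebra_simps)
  have "?E (\<lambda>M. (real (overlap N T M))\<^sup>2)
      = 2 * ?E (\<lambda>M. real (overlap N T M choose 2)) + overlap_expectation N T m"
    unfolding sq overlap_expectation_def using int by simp
  thus ?thesis
    using measure_pmf.variance_eq[OF int int, of "\<lambda>M. real (overlap N T M)"]
    by (simp add: overlap_variance_def overlap_expectation_def)
qed

text \<open>
  Negative correlation of two points under sampling without replacement; in essence
  \<open>(m - 1) / (n - 1) \<le> m / n\<close>. For \<open>n = 1\<close> the left-hand side is \<open>0\<close>.
\<close>
lemma choose_two_ratio_le: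
  assumes "m \<le> n"
  shows "real (m choose 2) / real (n choose 2) \<le> (real m / real n)\<^sup>2"
proof (cases "n \<ge> 2")
  case True
  have "real (m choose 2) / real (n choose 2)
      = (2 * real (m choose 2)) / (2 * real (n choose 2))" by simp
  also have "\<dots> = (real m / real n) * ((real m - 1) / (real n - 1))"
    by (simp only: real_choose_two times_divide_times_eq)
  also have "\<dots> \<le> (real m / real n) * (real m / real n)"
  proof (rule mult_left_mono)
    show "(real m - 1) / (real n - 1) \<le> real m / real n"
      using True assms by (simp add: divide_simps algebra_simps)
  qed simp
  finally show ?thesis by (simp add: power2_eq_square)
next
  case False
  thus ?thesis by (simp add: binomial_eq_0)
qed

lemma admissible_bounds:
  assumes "admissible N T n m"
  shows "overlap_expectation N T m > 0"
    and "overlap_expectation N T m - overlap_variance N T m > 0"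
    and "overlap_expectation N T m - overlap_variance N T m \<le> (overlap_expectation N T m)\<^sup>2"
proof -
  have N: "finite N" "n = card N" "n \<ge> 1" and m: "\<And>i. i \<in> {1..T} \<Longrightarrow> 1 \<le> m i \<and> m i \<le> card N"
    using assms by (auto simp: admissible_def)
  have le: "\<And>i. i \<in> {1..T} \<Longrightarrow> m i \<le> card N" using m by blast
  define p q where "p = (\<Prod>i\<in>{1..T}. real (m i) / real n)"
    and "q = (\<Prod>i\<in>{1..T}. real (m i choose 2) / real (n choose 2))"
  have E: "overlap_expectation N T m = real n * p"
    using expectation_overlap_choose[of N T m 1, OF N(1) le] N(2)
    by (simp add: overlap_expectation_def p_def)
  have diff: "overlap_expectation N T m - overlap_variance N T m
      = (real n * p)\<^sup>2 - 2 * real (n choose 2) * q"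
    using expectation_minus_variance[of N T m, OF N(1) le]
      expectation_overlap_choose[of N T m 2, OF N(1) le] E N(2)
    by (simp add: q_def)
  have p: "p > 0"
    unfolding p_def using m N(3) by (intro prod_pos) (fastforce intro: divide_pos_pos)
  have q: "q \<ge> 0" by (simp add: q_def prod_nonneg)
  have "q \<le> p\<^sup>2"
    unfolding p_def q_def prod_power_distrib
    using le N(2) by (intro prod_mono) (auto intro: choose_two_ratio_le)
  hence "2 * real (n choose 2) * q \<le> 2 * real (n choose 2) * p\<^sup>2"
    by (intro mult_left_mono) auto
  also have "\<dots> < (real n)\<^sup>2 * p\<^sup>2"
    using N(3) p by (intro mult_strict_right_mono)
      (auto simp: real_choose_two power2_eq_square algebra_simps)
  finally have "2 * real (n choose 2) * q < (real n * p)\<^sup>2" by (simp add: power_mult_distrib)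
  thus "overlap_expectation N T m - overlap_variance N T m > 0" using diff by simp
  show "overlap_expectation N T m > 0" using E p N(3) by simp
  show "overlap_expectation N T m - overlap_variance N T m \<le> (overlap_expectation N T m)\<^sup>2"
    using diff E q by simp
qed

theorem mainTheorem4:
  shows "(\<forall>(N :: 'a set) T n m. admissible N T n m \<longrightarrow>
            overlap_expectation N T m > overlap_variance N T m) \<and>
         (\<forall>(N :: nat \<Rightarrow> 'a set) T n m. (\<forall>k. admissible (N k) (T k) (n k) (m k)) \<longrightarrow>
            (\<lambda>k. overlap_expectation (N k) (T k) (m k)) \<longlonglongrightarrow> 0 \<longrightarrow>
            (\<lambda>k. (overlap_expectation (N k) (T k) (m k) - overlap_variance (N k) (T k) (m k))
                   / overlap_expectation (N k) (T k) (m k)) \<longlonglongrightarrow> 0)"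
proof (intro conjI allI impI)
  fix N :: "'a set" and T n m
  assume "admissible N T n m"
  from admissible_bounds(2)[OF this] show "overlap_expectation N T m > overlap_variance N T m"
    by simp
next
  fix N :: "nat \<Rightarrow> 'a set" and T n m
  assume adm: "\<forall>k. admissible (N k) (T k) (n k) (m k)"
  let ?E = "\<lambda>k. overlap_expectation (N k) (T k) (m k)"
  let ?V = "\<lambda>k. overlap_variance (N k) (T k) (m k)"
  assume lim: "?E \<longlonglongrightarrow> 0"
  note bounds = admissible_bounds[OF adm[rule_format]]
  have "0 \<le> (?E k - ?V k) / ?E k" for k
    using bounds(1,2)[of k] by (intro divide_nonneg_nonneg) auto
  moreover have "(?E k - ?V k) / ?E k \<le> ?E k" for k
    using bounds(1,3)[of k] by (simp add: pos_divide_le_eq power2_eq_square)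
  ultimately show "(\<lambda>k. (?E k - ?V k) / ?E k) \<longlonglongrightarrow> 0"
    by (intro tendsto_sandwich[OF _ _ tendsto_const lim] always_eventually) auto
qed

end
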